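(* Let $G$ be a pendant-free graph and let $\mathcal{C}_E$ be an edge-identifying code of $G$ with $|\mathcal{C}_E|=k$. Then $$|E(G)| \leq \begin{cases} \binom{\frac{4}{3}k}{2}, & \text{if } k\equiv 0 \bmod 3,\\[4pt] \binom{\frac{4}{3}(k-1)+1}{2}+1, & \text{if } k\equiv 1 \bmod 3,\\[4pt] \binom{\frac{4}{3}(k-2)+2}{2}+2, & \text{if } k\equiv 2 \bmod 3.\end{cases}$$
   Context: Graphs are finite and simple, with nonempty edge set. For an edge $e$ of a graph $G$, $N[e]$ denotes the set consisting of $e$ and all edges of $G$ adjacent to $e$ (i.e. sharing an endpoint with $e$). A subset $\mathcal{C}_E\subseteq E(G)$ is an edge-identifying code of $G$ if $N[e]\cap\mathcal{C}_E\neq\emptyset$ for every $e\in E(G)$, and $N[e]\cap\mathcal{C}_E\neq N[f]\cap\mathcal{C}_E$ for all distinct $e,f\in E(G)$. A pair of adjacent edges $ux,uy$ ($x\neq y$) of $G$ is pendant if either both $x$ and $y$ have degree $1$ in $G$, or both $x$ and $y$ have degree $2$ in $G$ and $xy\in E(G)$; $G$ is pendant-free if it has no pendant pair of edges (equivalently, $N[e]\neq N[f]$ for all distinct edges $e,f$, equivalently $G$ admits an edge-identifying code). *)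

theory Defs
  imports Complex_Main
begin

definition simple_graph :: "'a set \<Rightarrow> 'a set set \<Rightarrow> bool" where
  "simple_graph V E \<longleftrightarrow> finite V \<and> (\<forall>e\<in>E. e \<subseteq> V \<and> card e = 2) \<and> E \<noteq> {}"

definition adjacent_edges :: "'a set \<Rightarrow> 'a set \<Rightarrow> bool" where
  "adjacent_edges e f \<longleftrightarrow> e \<noteq> f \<and> e \<inter> f \<noteq> {}"

definition closed_edge_nbhd :: "'a set set \<Rightarrow> 'a set \<Rightarrow> 'a set set" where
  "closed_edge_nbhd E e = insert e {f \<in> E. adjacent_edges e f}"

definition edge_identifying_code :: "'a set set \<Rightarrow> 'a set set \<Rightarrow> bool" where
  "edge_identifying_code E C \<longleftrightarrow>
     C \<subseteq> E \<and>
     (\<forall>e\<in>E. closed_edge_nbhd E e \<inter> C \<noteq> {}) \<and>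
     (\<forall>e\<in>E. \<forall>f\<in>E. e \<noteq> f \<longrightarrow> closed_edge_nbhd E e \<inter> C \<noteq> closed_edge_nbhd E f \<inter> C)"

definition vertex_degree :: "'a set set \<Rightarrow> 'a \<Rightarrow> nat" where
  "vertex_degree E v = card {e \<in> E. v \<in> e}"

definition pendant_pair :: "'a set set \<Rightarrow> 'a set \<Rightarrow> 'a set \<Rightarrow> bool" where
  "pendant_pair E e f \<longleftrightarrow>
     e \<in> E \<and> f \<in> E \<and>
     (\<exists>u x y. e = {u, x} \<and> f = {u, y} \<and> x \<noteq> y \<and>
        (vertex_degree E x = 1 \<and> vertex_degree E y = 1 \<or>
         vertex_degree E x = 2 \<and> vertex_degree E y = 2 \<and> {x, y} \<in> E))"

definition pendant_free :: "'a set set \<Rightarrow> bool" where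
  "pendant_free E \<longleftrightarrow> \<not> (\<exists>e f. pendant_pair E e f)"

end

theory Submission
  imports Defs
begin

text \<open>
  Let \<open>C\<close> be the code, and call the set of code edges at a vertex its star. The code edges that
  see an edge \<open>{u, v}\<close> are exactly those in the union of the stars of \<open>u\<close> and \<open>v\<close>, and this union
  determines the edge. So with \<open>s\<close> distinct nonempty stars there are at most as many edges as there
  are sets of one or two stars, that is \<open>s + (s choose 2)\<close>.

  This count is improved where two such sets have the same union. Let a code edge \<open>c = {x, v}\<close> hang
  at \<open>v\<close>, meaning that \<open>x\<close> has degree 1 and \<open>v\<close> has degree at least 2 in the graph formed by \<open>C\<close>.
  Call it thin if \<open>v\<close> has degree exactly 2 there, and let \<open>w\<close> be the second neighbour of \<open>v\<close>. Then
  the stars of \<open>x\<close> and \<open>v\<close> have the same union as the star of \<open>v\<close> alone, and the stars of \<open>x\<close> and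
  \<open>w\<close> have the same union as those of \<open>v\<close> and \<open>w\<close>. With \<open>a\<close> thin edges this makes \<open>2 * a\<close> pairs of
  stars superfluous (\<open>card_star_unions\<close>).

  The code also has to separate its own edges, so two code edges never hang at the same vertex.
  Counting degrees, this single fact gives both \<open>2 * s \<le> 2 * k + a\<close> and \<open>3 * s \<le> 4 * k\<close>
  (\<open>twice_card_stars\<close>, \<open>thrice_card_stars\<close>).

  Since \<open>s + (s choose 2)\<close> grows with \<open>s\<close>, it may be assumed that \<open>s = k + t\<close> with \<open>t \<ge> 0\<close>. Then
  \<open>2 * t \<le> a\<close> and \<open>3 * t \<le> k\<close>, and the number of edges is at most \<open>s + (s choose 2) - 4 * t\<close>. In
  the range \<open>t \<le> k div 3\<close> this quantity does not decrease when \<open>t\<close> grows, and at \<open>t = k div 3\<close> it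
  equals the claimed bound. The value \<open>t = k div 3\<close> is reached, for instance, by codes made of
  disjoint paths with three edges, each having two thin edges, and of at most two isolated edges.
\<close>

section \<open>Stars, pendant edges and the degree count\<close>

definition star :: "'a set set \<Rightarrow> 'a \<Rightarrow> 'a set set" where
  "star C v = {c \<in> C. v \<in> c}"

definition leaves :: "'a set set \<Rightarrow> 'a set" where
  "leaves C = {v. card (star C v) = 1}"

definition core :: "'a set set \<Rightarrow> 'a set" where
  "core C = {v. 2 \<le> card (star C v)}"

definition edges_with_leaves :: "'a set set \<Rightarrow> nat \<Rightarrow> 'a set set" where
  "edges_with_leaves C j = {c \<in> C. card (c \<inter> leaves C) = j}"

abbreviation hanging :: "'a set set \<Rightarrow> 'a set set" where
  "hanging C \<equiv> edges_with_leaves C 1"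

definition attachment :: "'a set set \<Rightarrow> 'a set \<Rightarrow> 'a" where
  "attachment C c = the_elem (c \<inter> core C)"

definition thin :: "'a set set \<Rightarrow> 'a set set" where
  "thin C = {c \<in> hanging C. card (star C (attachment C c)) = 2}"

definition stars :: "'a set set \<Rightarrow> 'a set set set" where
  "stars C = star C ` \<Union>C"

lemma sum_card_star:
  assumes "finite C" "finite X"
  shows "(\<Sum>v\<in>X. card (star C v)) = (\<Sum>c\<in>C. card (c \<inter> X))"
proof -
  have "(\<Sum>v\<in>X. card (star C v)) = (\<Sum>v\<in>X. \<Sum>c\<in>C. if v \<in> c then 1 else 0)"
    using assms by (simp add: star_def sum.If_cases Int_def)
  also have "\<dots> = (\<Sum>c\<in>C. \<Sum>v\<in>X. if v \<in> c then 1 else 0)"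
    by (rule sum.swap)
  also have "\<dots> = (\<Sum>c\<in>C. card (c \<inter> X))"
    using assms by (intro sum.cong refl) (simp add: sum.If_cases Int_def conj_commute)
  finally show ?thesis .
qed

text \<open>
  A code separates all edges of its graph, in particular its own edges. This restriction, which no
  longer mentions the ambient graph, is what limits the shape of the code.
\<close>

locale self_separating =
  fixes C :: "'a set set"
  assumes finite_C: "finite C"
    and card_edge: "c \<in> C \<Longrightarrow> card c = 2"
    and separated: "inj_on (\<lambda>c. \<Union>(star C ` c)) C"
begin

lemma finite_edge: "c \<in> C \<Longrightarrow> finite c"
  using card_edge by (metis card.infinite zero_neq_numeral)

lemma finite_star: "finite (star C v)"
  using finite_C by (simp add: star_def)

lemma finite_vertices: "finite (\<Union>C)"
  using finite_C finite_edge by blast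

lemma star_nonempty_iff: "star C v \<noteq> {} \<longleftrightarrow> v \<in> \<Union>C"
  by (auto simp: star_def)

lemma core_subset: "core C \<subseteq> \<Union>C"
proof
  fix v assume "v \<in> core C"
  then have "star C v \<noteq> {}" by (auto simp: core_def)
  then show "v \<in> \<Union>C" by (simp add: star_nonempty_iff)
qed

lemma finite_core: "finite (core C)"
  using core_subset finite_vertices finite_subset by blast

lemma leaf_or_core: "v \<in> \<Union>C \<longleftrightarrow> v \<in> leaves C \<or> v \<in> core C"
proof -
  have "v \<in> \<Union>C \<longleftrightarrow> card (star C v) \<noteq> 0"
    using star_nonempty_iff finite_star by simp
  then show ?thesis by (auto simp: leaves_def core_def)
qed

lemma leaf_not_core: "leaves C \<inter> core C = {}"
  by (auto simp: leaves_def core_def)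

lemma star_leaf: "\<lbrakk>x \<in> leaves C; c \<in> C; x \<in> c\<rbrakk> \<Longrightarrow> star C x = {c}"
proof -
  assume x: "x \<in> leaves C" "c \<in> C" "x \<in> c"
  then have "card (star C x) = 1" by (simp add: leaves_def)
  then obtain d where "star C x = {d}" by (rule card_1_singletonE)
  moreover have "c \<in> star C x" using x by (simp add: star_def)
  ultimately show ?thesis by simp
qed

lemma star_core_not_singleton: "v \<in> core C \<Longrightarrow> star C v \<noteq> {c}"
  by (auto simp: core_def)

lemma card_core_part:
  assumes "c \<in> C"
  shows "card (c \<inter> leaves C) + card (c \<inter> core C) = 2"
proof -
  have "c = (c \<inter> leaves C) \<union> (c \<inter> core C)"
    using assms leaf_or_core by blast
  moreover have "card ((c \<inter> leaves C) \<union> (c \<inter> core C)) = card (c \<inter> leaves C) + card (c \<inter> core C)"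
    using finite_edge[OF assms] leaf_not_core by (intro card_Un_disjoint) auto
  ultimately show ?thesis using card_edge[OF assms] by simp
qed

lemma edge_split:
  "C = edges_with_leaves C 0 \<union> hanging C \<union> edges_with_leaves C 2"
proof -
  have "card (c \<inter> leaves C) = 0 \<or> card (c \<inter> leaves C) = 1 \<or> card (c \<inter> leaves C) = 2"
    if "c \<in> C" for c
    using card_core_part[OF that] by linarith
  then show ?thesis unfolding edges_with_leaves_def by blast
qed

lemma finite_edges_with_leaves: "finite (edges_with_leaves C j)"
  using finite_C by (simp add: edges_with_leaves_def)

lemma card_C:
  "card C = card (edges_with_leaves C 0) + card (hanging C) + card (edges_with_leaves C 2)"
proof -
  have "card (edges_with_leaves C 0 \<union> hanging C \<union> edges_with_leaves C 2)
      = card (edges_with_leaves C 0) + card (hanging C) + card (edges_with_leaves C 2)"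
    using finite_edges_with_leaves
    by (subst card_Un_disjoint, simp, simp, force simp: edges_with_leaves_def)
       (subst card_Un_disjoint, auto simp: edges_with_leaves_def)
  then show ?thesis using edge_split by simp
qed

lemma sum_core_degrees:
  "(\<Sum>v\<in>core C. card (star C v)) = 2 * card (edges_with_leaves C 0) + card (hanging C)"
proof -
  have "(\<Sum>v\<in>core C. card (star C v)) = (\<Sum>c\<in>C. card (c \<inter> core C))"
    using finite_C finite_core by (rule sum_card_star)
  also have "\<dots> = (\<Sum>c\<in>C. (if card (c \<inter> leaves C) = 0 then 2 else 0)
                          + (if card (c \<inter> leaves C) = 1 then 1 else 0))"
    by (intro sum.cong refl) (use card_core_part in fastforce)
  also have "\<dots> = 2 * card (edges_with_leaves C 0) + card (hanging C)"
    using finite_C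
    by (simp only: sum.distrib sum.If_cases edges_with_leaves_def) (simp add: Int_def)
  finally show ?thesis .
qed

lemma core_attachment:
  assumes "c \<in> hanging C"
  shows "c \<inter> core C = {attachment C c}"
proof -
  have "card (c \<inter> core C) = 1"
    using assms card_core_part[of c] by (auto simp: edges_with_leaves_def)
  then obtain v where "c \<inter> core C = {v}" by (rule card_1_singletonE)
  then show ?thesis by (simp add: attachment_def)
qed

text \<open>
  The star of the leaf of a hanging edge lies in the star of the attachment. Hence the set that
  identifies the edge depends on the attachment only.
\<close>

lemma code_hanging:
  assumes "c \<in> hanging C"
  shows "\<Union>(star C ` c) = star C (attachment C c)"
proof -
  have c: "c \<in> C" using assms by (simp add: edges_with_leaves_def)
  have a: "attachment C c \<in> c" using core_attachment[OF assms] by blast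
  have "star C x \<subseteq> star C (attachment C c)" if "x \<in> c" for x
  proof (cases "x \<in> core C")
    case True
    then have "x = attachment C c" using core_attachment[OF assms] that by blast
    then show ?thesis by simp
  next
    case False
    then have "x \<in> leaves C" using that c leaf_or_core by blast
    then have "star C x = {c}" using c that by (rule star_leaf)
    then show ?thesis using a c by (simp add: star_def)
  qed
  then show ?thesis using a by blast
qed

lemma inj_attachment: "inj_on (attachment C) (hanging C)"
proof (rule inj_onI)
  fix c d assume "c \<in> hanging C" "d \<in> hanging C" "attachment C c = attachment C d"
  moreover from this have "\<Union>(star C ` c) = \<Union>(star C ` d)" by (simp add: code_hanging)
  ultimately show "c = d"
    using separated by (auto simp: inj_on_def edges_with_leaves_def)
qed

lemma attachment_in_core: "c \<in> hanging C \<Longrightarrow> attachment C c \<in> core C"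
  using core_attachment by blast

lemma card_hanging_le_core: "card (hanging C) \<le> card (core C)"
  using inj_attachment attachment_in_core finite_core by (intro card_inj_on_le) auto

lemma finite_stars: "finite (stars C)"
  using finite_vertices by (simp add: stars_def)

text \<open>
  All leaves of an edge have the same star, so the leaves contribute one star for each hanging
  edge and one for each isolated edge.
\<close>

lemma card_stars_le:
  "card (stars C) \<le> card (core C) + card (hanging C) + card (edges_with_leaves C 2)"
proof -
  let ?X = "star C ` core C \<union> (\<lambda>c. {c}) ` hanging C \<union> (\<lambda>c. {c}) ` edges_with_leaves C 2"
  have "stars C \<subseteq> ?X"
  proof
    fix S assume "S \<in> stars C"
    then obtain v c where v: "S = star C v" "v \<in> c" "c \<in> C" by (auto simp: stars_def)
    show "S \<in> ?X"
    proof (cases "v \<in> core C")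
      case True
      then show ?thesis using v by blast
    next
      case False
      then have l: "v \<in> leaves C" using v leaf_or_core by blast
      then have "S = {c}" using v star_leaf by blast
      moreover have "card (c \<inter> leaves C) \<noteq> 0" using l v finite_edge by auto
      then have "c \<notin> edges_with_leaves C 0" by (simp add: edges_with_leaves_def)
      then have "c \<in> hanging C \<union> edges_with_leaves C 2"
        using edge_split v(3) by blast
      ultimately show ?thesis by blast
    qed
  qed
  then have "card (stars C) \<le> card ?X"
    using finite_core finite_edges_with_leaves by (intro card_mono) auto
  also have "\<dots> \<le> card (star C ` core C) + card ((\<lambda>c. {c}) ` hanging C)
                 + card ((\<lambda>c. {c}) ` edges_with_leaves C 2)"
    by (intro order.trans[OF card_Un_le] add_mono order.refl card_Un_le)
  also have "\<dots> \<le> card (core C) + card (hanging C) + card (edges_with_leaves C 2)"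
    using finite_core finite_edges_with_leaves by (intro add_mono card_image_le) auto
  finally show ?thesis .
qed

text \<open>
  The discharging step: a hanging edge that is not thin is attached to its own vertex of degree
  at least 3, which pays for it with the excess of its degree over 2.
\<close>

lemma twice_card_stars: "2 * card (stars C) \<le> 2 * card C + card (thin C)"
proof -
  let ?D = "{v \<in> core C. 3 \<le> card (star C v)}"
  have "card (hanging C - thin C) \<le> card ?D"
  proof (rule card_inj_on_le)
    show "inj_on (attachment C) (hanging C - thin C)"
      using inj_attachment inj_on_subset by blast
    have "3 \<le> card (star C (attachment C c))" if "c \<in> hanging C - thin C" for c
      using attachment_in_core[of c] that by (auto simp: thin_def core_def)
    then show "attachment C ` (hanging C - thin C) \<subseteq> ?D"
      using attachment_in_core by auto
  qed (simp add: finite_core)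
  moreover have "card (hanging C) = card (thin C) + card (hanging C - thin C)"
  proof -
    have "thin C \<subseteq> hanging C" by (auto simp: thin_def)
    then show ?thesis
      using finite_edges_with_leaves
      by (metis card_Diff_subset card_mono finite_subset le_add_diff_inverse)
  qed
  moreover have "2 * card (core C) + card ?D \<le> (\<Sum>v\<in>core C. card (star C v))"
  proof -
    have "2 * card (core C) + card ?D
        = (\<Sum>v\<in>core C. 2 + (if 3 \<le> card (star C v) then 1 else 0))"
      by (subst sum.distrib) (use finite_core in \<open>simp add: sum.If_cases Int_def\<close>)
    also have "\<dots> \<le> (\<Sum>v\<in>core C. card (star C v))"
      by (intro sum_mono) (auto simp: core_def)
    finally show ?thesis .
  qed
  ultimately show ?thesis
    using card_stars_le card_C sum_core_degrees by linarith
qed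

lemma thrice_card_stars: "3 * card (stars C) \<le> 4 * card C"
proof -
  have "2 * card (core C) = (\<Sum>v\<in>core C. 2)" by simp
  also have "\<dots> \<le> (\<Sum>v\<in>core C. card (star C v))"
    by (intro sum_mono) (simp add: core_def)
  finally show ?thesis
    using card_stars_le card_C sum_core_degrees card_hanging_le_core by linarith
qed

section \<open>Unions of one or two stars\<close>

definition small_families :: "'a set set set set" where
  "small_families = {X. X \<subseteq> stars C \<and> (card X = 1 \<or> card X = 2)}"

lemma finite_small_families: "finite small_families"
proof (rule finite_subset)
  show "small_families \<subseteq> Pow (stars C)" by (auto simp: small_families_def)
  show "finite (Pow (stars C))" using finite_stars by simp
qed

lemma card_small_families:
  "card small_families = card (stars C) + (card (stars C) choose 2)"
proof -
  have "small_families = {X. X \<subseteq> stars C \<and> card X = 1} \<union> {X. X \<subseteq> stars C \<and> card X = 2}"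
    by (auto simp: small_families_def)
  moreover have "card ({X. X \<subseteq> stars C \<and> card X = 1} \<union> {X. X \<subseteq> stars C \<and> card X = 2})
      = card {X. X \<subseteq> stars C \<and> card X = 1} + card {X. X \<subseteq> stars C \<and> card X = 2}"
    using finite_stars by (intro card_Un_disjoint) auto
  ultimately show ?thesis
    using n_subsets[OF finite_stars, of 1] n_subsets[OF finite_stars, of 2] by simp
qed

lemma star_eq_imp_eq:
  assumes "v \<in> core C" "star C v = star C w"
  shows "v = w"
proof (rule ccontr)
  assume "v \<noteq> w"
  have "c = {v, w}" if "c \<in> star C v" for c
  proof -
    have "c \<in> C" "v \<in> c" "w \<in> c"
      using that assms(2) by (auto simp: star_def)
    then have "{v, w} \<subseteq> c" "card c = 2" "finite c" using card_edge finite_edge by auto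
    then show ?thesis using \<open>v \<noteq> w\<close> by (metis card_2_iff card_subset_eq)
  qed
  then have "star C v \<subseteq> {{v, w}}" by blast
  then have "card (star C v) \<le> 1" using card_mono[of "{{v, w}}"] by simp
  then show False using assms(1) by (simp add: core_def)
qed

text \<open>
  The neighbour \<open>w\<close> of the attachment \<open>v\<close> other than the leaf is not itself a leaf, since its edge
  would then be a second edge hanging at \<open>v\<close>.
\<close>

lemma thin_second_neighbour:
  assumes "c \<in> thin C"
  shows "\<exists>w. w \<in> core C \<and> w \<noteq> attachment C c
           \<and> star C (attachment C c) \<union> star C w = insert c (star C w)"
proof -
  define v where "v = attachment C c"
  have ch: "c \<in> hanging C" and deg: "card (star C v) = 2"
    using assms by (auto simp: thin_def v_def)
  have "c \<in> star C v"
    using core_attachment[OF ch] ch by (auto simp: star_def v_def edges_with_leaves_def)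
  with deg obtain d where d: "star C v = {c, d}" "d \<noteq> c"
    by (metis card_2_iff doubleton_eq_iff empty_iff insert_iff)
  then have dC: "d \<in> C" "v \<in> d" by (auto simp: star_def)
  then obtain w where w: "d = {v, w}" "w \<noteq> v"
    using card_edge[OF dC(1)] by (metis card_2_iff doubleton_eq_iff empty_iff insert_iff)
  have "w \<in> core C"
  proof (rule ccontr)
    assume nw: "w \<notin> core C"
    have vc: "v \<in> core C" using attachment_in_core[OF ch] by (simp add: v_def)
    then have core_d: "d \<inter> core C = {v}" using nw w by auto
    then have "card (d \<inter> leaves C) = 1" using card_core_part[OF dC(1)] by simp
    then have "d \<in> hanging C" using dC by (simp add: edges_with_leaves_def)
    moreover have "attachment C d = v" using core_d by (simp add: attachment_def)
    ultimately have "d = c" using inj_attachment ch by (auto simp: inj_on_def v_def)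
    then show False using d by simp
  qed
  moreover have "d \<in> star C w" using dC w by (simp add: star_def)
  then have "star C v \<union> star C w = insert c (star C w)" using d by auto
  ultimately show ?thesis using w by (auto simp: v_def)
qed

text \<open>
  A thin edge \<open>c\<close> with attachment \<open>v\<close> and second neighbour \<open>w\<close> makes two pairs superfluous: the pair
  of \<open>{c}\<close> and the star of \<open>v\<close> can be replaced by the star of \<open>v\<close> alone, and the pair of \<open>{c}\<close> and
  the star of \<open>w\<close> by the pair of the stars of \<open>v\<close> and \<open>w\<close>.
\<close>

lemma card_star_unions:
  "card (Union ` small_families) + 2 * card (thin C)
     \<le> card (stars C) + (card (stars C) choose 2)"
proof -
  obtain w where w: "\<And>c. c \<in> thin C \<Longrightarrow> w c \<in> core C \<and> w c \<noteq> attachment C c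
      \<and> star C (attachment C c) \<union> star C (w c) = insert c (star C (w c))"
    using thin_second_neighbour by metis
  have w_core: "w c \<in> core C" if "c \<in> thin C" for c using w[OF that] by simp
  have hang: "c \<in> hanging C" if "c \<in> thin C" for c using that by (simp add: thin_def)
  have att: "attachment C c \<in> core C" if "c \<in> thin C" for c
    using attachment_in_core hang that by blast
  have star_core: "star C v \<in> stars C" if "v \<in> core C" for v
    using that core_subset by (auto simp: stars_def)
  have singleton: "{c} \<in> stars C" if "c \<in> thin C" for c
  proof -
    have c: "c \<in> C" "card (c \<inter> leaves C) = 1"
      using hang[OF that] by (auto simp: edges_with_leaves_def)
    then have "c \<inter> leaves C \<noteq> {}" by force
    then obtain x where "x \<in> c" "x \<in> leaves C" by blast
    then have "star C x = {c}" "x \<in> \<Union>C" using c star_leaf by auto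
    then show ?thesis unfolding stars_def by (metis image_eqI)
  qed
  \<comment> \<open>The superfluous pairs. Each contains exactly one singleton, from which the thin edge can be
    read off.\<close>
  define f where "f c = {{c}, star C (attachment C c)}" for c
  define g where "g c = {{c}, star C (w c)}" for c
  have f_pair: "card (f c) = 2" if "c \<in> thin C" for c
    using star_core_not_singleton[OF att[OF that], of c] by (auto simp: f_def card_2_iff)
  have g_pair: "card (g c) = 2" if "c \<in> thin C" for c
    using star_core_not_singleton[of "w c" c] w[OF that] by (auto simp: g_def card_2_iff)
  have pair_eq: "c = d \<and> star C v = star C u"
    if "{{c}, star C v} = {{d}, star C u}" "v \<in> core C" "u \<in> core C" for c d v u
  proof -
    have "{c} \<noteq> star C u" using star_core_not_singleton[OF that(3), of c] by metis
    then show ?thesis using that(1) by (auto simp: doubleton_eq_iff)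
  qed
  have "inj_on f (thin C)"
    unfolding f_def using pair_eq[OF _ att att] by (intro inj_onI) simp
  moreover have "inj_on g (thin C)"
    unfolding g_def using pair_eq[OF _ w_core w_core] by (intro inj_onI) simp
  moreover have "f ` thin C \<inter> g ` thin C = {}"
  proof -
    have False if cd: "c \<in> thin C" "d \<in> thin C" "f c = g d" for c d
    proof -
      have "c = d \<and> star C (attachment C c) = star C (w d)"
        using pair_eq[OF _ att[OF cd(1)] w_core[OF cd(2)]] cd(3) by (simp only: f_def g_def)
      then show False using star_eq_imp_eq[OF att[OF cd(1)]] w[OF cd(2)] by metis
    qed
    then show ?thesis by blast
  qed
  moreover have "finite (thin C)"
    using finite_C by (simp add: thin_def edges_with_leaves_def)
  ultimately have card_R: "card (f ` thin C \<union> g ` thin C) = 2 * card (thin C)"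
    by (simp add: card_Un_disjoint card_image)
  let ?R = "f ` thin C \<union> g ` thin C"
  have R_sub: "?R \<subseteq> small_families"
  proof -
    have "f c \<in> small_families" "g c \<in> small_families" if "c \<in> thin C" for c
      using f_pair[OF that] g_pair[OF that] singleton[OF that] star_core att[OF that] w[OF that]
      by (simp_all add: small_families_def f_def g_def)
    then show ?thesis by blast
  qed
  \<comment> \<open>The families that replace the superfluous pairs are not superfluous themselves: their members
    are stars of core vertices, which have at least two edges.\<close>
  have no_R: "X \<notin> ?R" if "\<And>c. {c} \<notin> X" for X
    using that by (auto simp: f_def g_def)
  have "Union ` small_families \<subseteq> Union ` (small_families - ?R)"
  proof
    fix Y assume "Y \<in> Union ` small_families"
    then obtain X where X: "X \<in> small_families" "Y = \<Union>X" by blast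
    consider "X \<notin> ?R" | c where "c \<in> thin C" "X = f c" | c where "c \<in> thin C" "X = g c"
      by blast
    then show "Y \<in> Union ` (small_families - ?R)"
    proof cases
      case 1
      then show ?thesis using X by blast
    next
      case (2 c)
      have "c \<in> star C (attachment C c)"
        using core_attachment[OF hang] hang 2(1) by (auto simp: star_def edges_with_leaves_def)
      then have "Y = \<Union>{star C (attachment C c)}" using X 2 by (auto simp: f_def)
      moreover have "{star C (attachment C c)} \<in> small_families"
        using star_core att 2 by (simp add: small_families_def)
      moreover have "{star C (attachment C c)} \<notin> ?R"
        using star_core_not_singleton[OF att[OF 2(1)]] by (intro no_R) auto
      ultimately show ?thesis by blast
    next
      case (3 c)
      let ?Z = "{star C (attachment C c), star C (w c)}"
      have wc: "w c \<in> core C" "w c \<noteq> attachment C c" using w 3 by auto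
      have "Y = \<Union>?Z" using X 3 w by (auto simp: g_def)
      moreover have "star C (attachment C c) \<noteq> star C (w c)"
        using star_eq_imp_eq[OF att[OF 3(1)]] wc by metis
      then have "?Z \<in> small_families"
        using star_core att[OF 3(1)] wc by (simp add: small_families_def)
      moreover have "?Z \<notin> ?R"
        using star_core_not_singleton att[OF 3(1)] wc by (intro no_R) (metis insertE singletonD)
      ultimately show ?thesis by blast
    qed
  qed
  then have "card (Union ` small_families) \<le> card (small_families - ?R)"
    using finite_small_families by (intro surj_card_le) auto
  also have "\<dots> = card small_families - card ?R"
    using R_sub finite_small_families by (meson card_Diff_subset finite_subset)
  finally show ?thesis
    using card_R card_small_families card_mono[OF finite_small_families R_sub] by linarith
qed

end

section \<open>From codes to unions of stars\<close>

lemma closed_edge_nbhd_Int_code: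
  assumes "C \<subseteq> E" "card e = 2"
  shows "closed_edge_nbhd E e \<inter> C = \<Union>(star C ` e)"
proof -
  have "e \<inter> e \<noteq> {}" using assms(2) by auto
  then have "closed_edge_nbhd E e \<inter> C = {c \<in> C. e \<inter> c \<noteq> {}}"
    using assms(1) unfolding closed_edge_nbhd_def adjacent_edges_def by blast
  also have "\<dots> = \<Union>(star C ` e)"
    unfolding star_def by blast
  finally show ?thesis .
qed

text \<open>
  The hypotheses leave only the excess \<open>t\<close> of \<open>s\<close> over \<open>k\<close> free, and the resulting bound is largest at
  \<open>t = k div 3\<close>.
\<close>

lemma binomial_bound:
  fixes N s a k :: nat
  assumes N: "N + 2 * a \<le> s + (s choose 2)"
    and a: "2 * s \<le> 2 * k + a" and s: "3 * s \<le> 4 * k"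
  shows "N \<le> ((4 * (k div 3) + k mod 3) choose 2) + k mod 3"
proof -
  define q r t d where "q = k div 3" and "r = k mod 3" and "t = s - k" and "d = q - t"
  have k: "k = 3 * q + r" "r < 3" by (auto simp: q_def r_def)
  have "t \<le> q" using s k by (simp add: t_def)
  then have q: "q = t + d" by (simp add: d_def)
  have dbl: "2 * int (n choose 2) = int n * (int n - 1)" for n
  proof -
    have "2 * (n choose 2) = n * (n - 1)"
      unfolding choose_two by (cases n) simp_all
    then have "2 * int (n choose 2) = int (n * (n - 1))" by linarith
    then show ?thesis by (cases n) (auto simp: algebra_simps)
  qed
  have "s choose 2 \<le> (k + t) choose 2"
    unfolding choose_two by (intro div_le_mono mult_le_mono) (auto simp: t_def)
  then have "N + 4 * t \<le> (k + t) + ((k + t) choose 2)"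
    using N a by (auto simp: t_def)
  then have "2 * int N + 8 * int t \<le> int (k + t) * (int (k + t) + 1)"
    using dbl[of "k + t"] by (simp add: algebra_simps)
  \<comment> \<open>Raising \<open>t\<close> by \<open>d\<close> to its maximum \<open>q\<close> changes twice the bound by this product.\<close>
  moreover have "int d * (2 * int (4 * q + r) - int d - 7) \<ge> 0"
    by (cases "d = 0") (use q in auto)
  ultimately have "2 * int N \<le> 2 * int ((4 * q + r) choose 2) + 2 * int r"
    unfolding dbl using k q by (simp add: algebra_simps)
  then have "N \<le> ((4 * q + r) choose 2) + r" by linarith
  then show ?thesis by (simp add: q_def r_def)
qed

theorem theorem16:
  fixes V :: "'a set" and E C :: "'a set set" and k :: nat
  assumes "simple_graph V E"
    and "pendant_free E"
    and "edge_identifying_code E C"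
    and "card C = k"
  shows "(k mod 3 = 0 \<longrightarrow> card E \<le> (4 * k div 3) choose 2) \<and>
         (k mod 3 = 1 \<longrightarrow> card E \<le> ((4 * (k - 1) div 3 + 1) choose 2) + 1) \<and>
         (k mod 3 = 2 \<longrightarrow> card E \<le> ((4 * (k - 2) div 3 + 2) choose 2) + 2)"
proof -
  let ?code = "\<lambda>e. \<Union>(star C ` e)"
  have card2: "card e = 2" if "e \<in> E" for e
    using assms(1) that by (simp add: simple_graph_def)
  have "E \<subseteq> Pow V" "finite V" using assms(1) by (auto simp: simple_graph_def)
  then have finE: "finite E" by (meson finite_Pow_iff finite_subset)
  have CE: "C \<subseteq> E" using assms(3) by (simp add: edge_identifying_code_def)
  have nbhd: "closed_edge_nbhd E e \<inter> C = ?code e" if "e \<in> E" for e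
    using closed_edge_nbhd_Int_code[OF CE card2[OF that]] .
  have inj: "inj_on ?code E"
  proof (rule inj_onI)
    fix e f assume "e \<in> E" "f \<in> E" "?code e = ?code f"
    then show "e = f"
      using assms(3) nbhd[of e] nbhd[of f] unfolding edge_identifying_code_def by metis
  qed
  interpret self_separating C
  proof
    show "finite C" using CE finE by (rule finite_subset)
    show "card c = 2" if "c \<in> C" for c using that CE card2 by blast
    show "inj_on ?code C" using inj CE by (rule inj_on_subset)
  qed
  have "?code ` E \<subseteq> Union ` small_families"
  proof
    fix Y assume "Y \<in> ?code ` E"
    then obtain e where e: "e \<in> E" "Y = ?code e" by blast
    \<comment> \<open>An end of \<open>e\<close> that is on no code edge contributes the empty star, which is dropped.\<close>
    let ?X = "star C ` e - {{}}"
    have "Y \<noteq> {}"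
      using assms(3) nbhd[OF e(1)] e unfolding edge_identifying_code_def by metis
    then have "?X \<noteq> {}" using e by auto
    have fe: "finite e" using card2[OF e(1)] by (metis card.infinite zero_neq_numeral)
    have "card ?X \<le> card (star C ` e)" using fe by (intro card_mono) auto
    also have "\<dots> \<le> 2" using card_image_le[OF fe, of "star C"] card2[OF e(1)] by simp
    finally have "card ?X \<le> 2" .
    moreover have "card ?X \<noteq> 0" using \<open>?X \<noteq> {}\<close> fe by simp
    ultimately have "card ?X = 1 \<or> card ?X = 2" by linarith
    moreover have "?X \<subseteq> stars C" using star_nonempty_iff by (auto simp: stars_def)
    ultimately have "?X \<in> small_families" by (simp add: small_families_def)
    moreover have "Y = \<Union>?X" using e by auto
    ultimately show "Y \<in> Union ` small_families" by blast
  qed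
  then have "card (?code ` E) \<le> card (Union ` small_families)"
    using finite_small_families by (intro card_mono) auto
  then have "card E \<le> card (Union ` small_families)" using card_image[OF inj] by simp
  then have "card E + 2 * card (thin C) \<le> card (stars C) + (card (stars C) choose 2)"
    using card_star_unions by linarith
  then have "card E \<le> ((4 * (k div 3) + k mod 3) choose 2) + k mod 3"
    using twice_card_stars thrice_card_stars assms(4) by (intro binomial_bound) auto
  moreover have "4 * (k - k mod 3) div 3 = 4 * (k div 3)"
  proof -
    have "k - k mod 3 = 3 * (k div 3)" by (simp add: minus_mod_eq_mult_div)
    then show ?thesis by simp
  qed
  ultimately show ?thesis by auto
qed

end
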